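(* Let $m,n \ge 1$ and let $A,B \in \mathbb{R}^{m \times n}$. Then: (a) every matrix in the interval hull $\mathbb{I}(A,B)$ is semipositive if and only if $I_l$ is semipositive; (b) every matrix in $\mathbb{I}(A,B)$ is minimally semipositive if and only if $I_l$ is semipositive and $I_u$ is minimally semipositive.
   Context: For $A=(a_{ij}), B=(b_{ij}) \in \mathbb{R}^{m\times n}$, the interval hull is $\mathbb{I}(A,B) = \{C \in \mathbb{R}^{m\times n} : c_{ij} = t_{ij} a_{ij} + (1-t_{ij}) b_{ij},\ t_{ij} \in [0,1]\}$, where the $t_{ij}$ are chosen independently for each entry. The $m \times n$ matrices $I_u$ and $I_l$ are defined by $(I_u)_{ij} = \max\{a_{ij},b_{ij}\}$ and $(I_l)_{ij} = \min\{a_{ij},b_{ij}\}$. Vector inequalities are entrywise: $x \ge 0$ means all entries are nonnegative, $y > 0$ means all entries are positive. An $m \times n$ real matrix $M$ is semipositive if there exists a vector $x \ge 0$ in $\mathbb{R}^n$ such that $Mx > 0$. An $m \times n$ real matrix is minimally semipositive if it is semipositive and no column-deleted submatrix of it (i.e. no matrix obtained from it by deleting one or more columns) is semipositive. *)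

theory Defs
  imports Complex_Main "Jordan_Normal_Form.Matrix" "Jordan_Normal_Form.DL_Submatrix"
begin

text \<open>The weights \<open>t i j\<close> may differ from entry to entry; \<open>B\<close> is meant to have the same
  dimensions as \<open>A\<close>.\<close>

definition interval_hull :: "real mat \<Rightarrow> real mat \<Rightarrow> real mat set" where
  "interval_hull A B = {C \<in> carrier_mat (dim_row A) (dim_col A).
     \<exists>t :: nat \<Rightarrow> nat \<Rightarrow> real. \<forall>i < dim_row A. \<forall>j < dim_col A.
       t i j \<in> {0..1} \<and> C $$ (i, j) = t i j * A $$ (i, j) + (1 - t i j) * B $$ (i, j)}"

definition upper_mat :: "real mat \<Rightarrow> real mat \<Rightarrow> real mat" where
  "upper_mat A B = mat (dim_row A) (dim_col A) (\<lambda>(i, j). max (A $$ (i, j)) (B $$ (i, j)))"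

definition lower_mat :: "real mat \<Rightarrow> real mat \<Rightarrow> real mat" where
  "lower_mat A B = mat (dim_row A) (dim_col A) (\<lambda>(i, j). min (A $$ (i, j)) (B $$ (i, j)))"

text \<open>The library order \<open><\<close> on vectors only means \<open>\<le>\<close> and not \<open>\<ge>\<close>; here positivity of a vector
  is strict in every entry.\<close>

definition positive_vec :: "real vec \<Rightarrow> bool" where
  "positive_vec y \<longleftrightarrow> (\<forall>i < dim_vec y. 0 < y $ i)"

definition semipositive :: "real mat \<Rightarrow> bool" where
  "semipositive M \<longleftrightarrow>
     (\<exists>x \<in> carrier_vec (dim_col M). 0\<^sub>v (dim_col M) \<le> x \<and> positive_vec (M *\<^sub>v x))"

text \<open>Keeping a proper subset \<open>J\<close> of the column indices amounts to deleting one or more columns.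
  \<open>J = {}\<close> is allowed; a matrix with at least one row and no columns is never semipositive.\<close>

definition minimally_semipositive :: "real mat \<Rightarrow> bool" where
  "minimally_semipositive M \<longleftrightarrow>
     semipositive M \<and> (\<forall>J. J \<subset> {..<dim_col M} \<longrightarrow> \<not> semipositive (submatrix M UNIV J))"

end

theory Submission
  imports Defs
begin

text \<open>Semipositivity is inherited upwards in the entrywise order
  (\<open>semipositive_mono\<close>), and the hull is an order interval whose least and greatest
  elements, \<open>lower_mat A B\<close> and \<open>upper_mat A B\<close>, themselves belong to it.
  Hence semipositivity of the whole hull is decided at its least element. Minimality asks in
  addition that submatrices fail to be semipositive. Deleting columns respects the order, so this
  failure is inherited downwards (\<open>minimally_semipositive_antimono\<close>) and is decided at
  the greatest element.\<close>

definition le_mat_entrywise :: "real mat \<Rightarrow> real mat \<Rightarrow> bool" where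
  "le_mat_entrywise A B \<longleftrightarrow> dim_row A = dim_row B \<and> dim_col A = dim_col B \<and>
     (\<forall>i < dim_row A. \<forall>j < dim_col A. A $$ (i, j) \<le> B $$ (i, j))"

text \<open>A witness \<open>x\<close> for \<open>A\<close> also serves for \<open>B\<close>: since
  \<open>x\<close> has no negative entry, raising the entries of a row cannot lower its product with
  \<open>x\<close>.\<close>

lemma semipositive_mono:
  assumes le: "le_mat_entrywise A B" and "semipositive A"
  shows "semipositive B"
proof -
  obtain x where x: "x \<in> carrier_vec (dim_col A)" "0\<^sub>v (dim_col A) \<le> x"
    and pos: "positive_vec (A *\<^sub>v x)"
    using assms(2) by (auto simp: semipositive_def)
  have "0 < (B *\<^sub>v x) $ i" if i: "i < dim_row B" for i
  proof -
    have "0 < (A *\<^sub>v x) $ i"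
      using pos le i by (simp add: positive_vec_def le_mat_entrywise_def)
    also have "\<dots> = (\<Sum>j<dim_col A. A $$ (i, j) * x $ j)"
      using x le i by (auto simp: scalar_prod_def le_mat_entrywise_def atLeast0LessThan intro!: sum.cong)
    also have "\<dots> \<le> (\<Sum>j<dim_col A. B $$ (i, j) * x $ j)"
      using x le i
      by (intro sum_mono mult_right_mono) (auto simp: le_mat_entrywise_def less_eq_vec_def)
    also have "\<dots> = (B *\<^sub>v x) $ i"
      using x le i by (auto simp: scalar_prod_def le_mat_entrywise_def atLeast0LessThan intro!: sum.cong)
    finally show ?thesis .
  qed
  then have "positive_vec (B *\<^sub>v x)"
    by (simp add: positive_vec_def)
  then show ?thesis
    using x le by (auto simp: semipositive_def le_mat_entrywise_def)
qed

text \<open>The dimensions agree, so the same \<open>I\<close> and \<open>J\<close> pick the same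
  positions in both matrices; \<open>pick_le\<close> keeps these positions in range.\<close>

lemma le_mat_entrywise_submatrix:
  assumes "le_mat_entrywise A B"
  shows "le_mat_entrywise (submatrix A I J) (submatrix B I J)"
  using assms
  by (auto simp: le_mat_entrywise_def dim_submatrix submatrix_index pick_le)

lemma interval_hull_bounds:
  assumes "C \<in> interval_hull A B"
  shows "le_mat_entrywise (lower_mat A B) C" "le_mat_entrywise C (upper_mat A B)"
proof -
  have dim: "dim_row C = dim_row A" "dim_col C = dim_col A"
    using assms by (auto simp: interval_hull_def)
  obtain t :: "nat \<Rightarrow> nat \<Rightarrow> real" where t: "\<forall>i < dim_row A. \<forall>j < dim_col A. t i j \<in> {0..1} \<and>
      C $$ (i, j) = t i j * A $$ (i, j) + (1 - t i j) * B $$ (i, j)"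
    using assms unfolding interval_hull_def mem_Collect_eq by (elim conjE exE)
  have "min (A $$ (i, j)) (B $$ (i, j)) \<le> C $$ (i, j) \<and>
      C $$ (i, j) \<le> max (A $$ (i, j)) (B $$ (i, j))"
    if i: "i < dim_row A" and j: "j < dim_col A" for i j
  proof -
    let ?t = "t i j" and ?l = "min (A $$ (i, j)) (B $$ (i, j))" and ?u = "max (A $$ (i, j)) (B $$ (i, j))"
    have t01: "0 \<le> ?t" "0 \<le> 1 - ?t"
      and C: "C $$ (i, j) = ?t * A $$ (i, j) + (1 - ?t) * B $$ (i, j)"
      using t[rule_format, OF i j] by simp_all
    \<comment> \<open>The bound \<open>?l\<close> is written as a combination of itself with the
      weights of \<open>C\<close>, so that it can be compared term by term; the weights sum to 1 and
      are merged again at the end. The same is done for \<open>?u\<close>.\<close>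
    have "?t * ?l + (1 - ?t) * ?l \<le> C $$ (i, j)"
      unfolding C by (intro add_mono mult_left_mono t01 min.cobounded1 min.cobounded2)
    moreover have "C $$ (i, j) \<le> ?t * ?u + (1 - ?t) * ?u"
      unfolding C by (intro add_mono mult_left_mono t01 max.cobounded1 max.cobounded2)
    ultimately show ?thesis
      unfolding distrib_right[symmetric] by simp
  qed
  with dim show "le_mat_entrywise (lower_mat A B) C" "le_mat_entrywise C (upper_mat A B)"
    by (simp_all add: le_mat_entrywise_def lower_mat_def upper_mat_def)
qed

lemma lower_mat_in_interval_hull: "lower_mat A B \<in> interval_hull A B"
proof -
  \<comment> \<open>Weights are free in each entry, so 0 and 1 suffice: 1 selects the entry of
    \<open>A\<close> exactly where it is the smaller one.\<close>
  let ?t = "\<lambda>i j. if A $$ (i, j) \<le> B $$ (i, j) then 1 else 0 :: real"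
  have "\<forall>i < dim_row A. \<forall>j < dim_col A. ?t i j \<in> {0..1} \<and>
      lower_mat A B $$ (i, j) = ?t i j * A $$ (i, j) + (1 - ?t i j) * B $$ (i, j)"
    by (simp add: lower_mat_def)
  moreover have "lower_mat A B \<in> carrier_mat (dim_row A) (dim_col A)"
    by (simp add: lower_mat_def)
  ultimately show ?thesis
    unfolding interval_hull_def mem_Collect_eq by (intro conjI exI[of _ ?t])
qed

lemma upper_mat_in_interval_hull: "upper_mat A B \<in> interval_hull A B"
proof -
  let ?t = "\<lambda>i j. if A $$ (i, j) \<le> B $$ (i, j) then 0 else 1 :: real"
  have "\<forall>i < dim_row A. \<forall>j < dim_col A. ?t i j \<in> {0..1} \<and>
      upper_mat A B $$ (i, j) = ?t i j * A $$ (i, j) + (1 - ?t i j) * B $$ (i, j)"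
    by (simp add: upper_mat_def)
  moreover have "upper_mat A B \<in> carrier_mat (dim_row A) (dim_col A)"
    by (simp add: upper_mat_def)
  ultimately show ?thesis
    unfolding interval_hull_def mem_Collect_eq by (intro conjI exI[of _ ?t])
qed

text \<open>A semipositive column-deleted submatrix of \<open>A\<close> would force the
  corresponding one of \<open>B\<close> to be semipositive. Semipositivity of \<open>A\<close>
  itself is a separate hypothesis because it does not pass downwards from \<open>B\<close>.\<close>

lemma minimally_semipositive_antimono:
  assumes "le_mat_entrywise A B" "semipositive A" "minimally_semipositive B"
  shows "minimally_semipositive A"
proof -
  have "\<not> semipositive (submatrix A UNIV J)" if "J \<subset> {..<dim_col A}" for J
    using assms that semipositive_mono[OF le_mat_entrywise_submatrix[OF assms(1), of UNIV J]]
    unfolding minimally_semipositive_def le_mat_entrywise_def by metis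
  with assms(2) show ?thesis
    by (simp add: minimally_semipositive_def)
qed

theorem theorem5p1:
  fixes A B :: "real mat" and m n :: nat
  assumes "m \<ge> 1" and "n \<ge> 1"
    and "A \<in> carrier_mat m n" and "B \<in> carrier_mat m n"
  shows "((\<forall>C \<in> interval_hull A B. semipositive C) \<longleftrightarrow> semipositive (lower_mat A B)) \<and>
    ((\<forall>C \<in> interval_hull A B. minimally_semipositive C) \<longleftrightarrow>
       semipositive (lower_mat A B) \<and> minimally_semipositive (upper_mat A B))"
proof -
  have a: "(\<forall>C \<in> interval_hull A B. semipositive C) \<longleftrightarrow> semipositive (lower_mat A B)"
    by (meson lower_mat_in_interval_hull semipositive_mono interval_hull_bounds(1))
  moreover have "minimally_semipositive C"
    if "semipositive (lower_mat A B)" "minimally_semipositive (upper_mat A B)"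
      "C \<in> interval_hull A B" for C
  \<comment> \<open>The comparison is with the upper matrix; semipositivity of \<open>C\<close>
    comes from the lower one through part (a).\<close>
  proof (rule minimally_semipositive_antimono)
    show "le_mat_entrywise C (upper_mat A B)"
      using that(3) by (rule interval_hull_bounds(2))
  qed (use that a in blast)+
  \<comment> \<open>For the forward direction of (b), evaluated at the two extreme matrices: at the
    lower one only semipositivity is kept.\<close>
  moreover have "semipositive C" if "minimally_semipositive C" for C
    using that by (simp add: minimally_semipositive_def)
  ultimately show ?thesis
    using lower_mat_in_interval_hull[of A B] upper_mat_in_interval_hull[of A B] by blast
qed

end
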